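(* Let $A,B\in M_2$. If $\operatorname{tr} A=0$ and $\frac12\operatorname{tr} B\in W(B_0)$, then $W_A(B)=W_{A\oplus 0}(B\oplus 0)$.
   Context: $M_n$ is the space of $n\times n$ complex matrices and $U_n$ the group of $n\times n$ unitary matrices. For $B\in M_n$, the classical numerical range is $W(B)=\{x^*Bx : x\in\mathbb{C}^n,\ x^*x=1\}$. For $A,B\in M_n$, the $A$-numerical range of $B$ is $W_A(B)=\{\operatorname{tr}(A\,VBV^* ) : V\in U_n\}$. For $B\in M_2$, $B_0=B-\left(\frac12\operatorname{tr}B\right)I\in M_2$. For $X\in M_2$, $X\oplus 0\in M_3$ denotes the direct sum of $X$ with the $1\times 1$ zero matrix. *)

theory Defs
  imports "Jordan_Normal_Form.Schur_Decomposition"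
begin

text \<open>A matrix in \<open>M\<^sub>n\<close> is an element of \<^term>\<open>carrier_mat n n :: complex mat set\<close>.
  All notions below are meant for square matrices, whose size is read off from \<^const>\<open>dim_row\<close>.\<close>

definition mat_trace :: "complex mat \<Rightarrow> complex" where
  "mat_trace A = (\<Sum>i<dim_row A. A $$ (i, i))"

definition unitary_mats :: "nat \<Rightarrow> complex mat set" where
  "unitary_mats n =
     {V \<in> carrier_mat n n. mat_adjoint V * V = 1\<^sub>m n \<and> V * mat_adjoint V = 1\<^sub>m n}"

text \<open>The scalar \<open>x\<^sup>* B x\<close> is written \<open>(B *\<^sub>v x) \<bullet>c x\<close>, since \<open>\<bullet>c\<close> conjugates its second argument;
  likewise \<open>x\<^sup>* x\<close> is \<open>x \<bullet>c x\<close>.\<close>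

definition num_range :: "complex mat \<Rightarrow> complex set" where
  "num_range B = {(B *\<^sub>v x) \<bullet>c x | x. x \<in> carrier_vec (dim_row B) \<and> x \<bullet>c x = 1}"

definition rel_num_range :: "complex mat \<Rightarrow> complex mat \<Rightarrow> complex set" where
  "rel_num_range A B =
     {mat_trace (A * (V * B * mat_adjoint V)) | V. V \<in> unitary_mats (dim_row B)}"

text \<open>The matrix \<open>B\<^sub>0\<close>, for \<open>2 \<times> 2\<close> matrices \<open>B\<close> only.\<close>

definition traceless_part :: "complex mat \<Rightarrow> complex mat" where
  "traceless_part B = B - (1 / 2 * mat_trace B) \<cdot>\<^sub>m 1\<^sub>m 2"

text \<open>The direct sum \<open>X \<oplus> 0\<close> with the \<open>1 \<times> 1\<close> zero matrix.\<close>

definition pad_zero :: "complex mat \<Rightarrow> complex mat" where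
  "pad_zero X = diag_block_mat [X, 0\<^sub>m 1 1]"

end

theory Submission
  imports Defs "HOL-Analysis.Convex"
begin

text \<open>
  Write \<open>W\<^sub>A(B)\<close> for the \<open>A\<close>-numerical range. The inclusion of \<open>W\<^sub>A(B)\<close> in the range of the padded
  matrices holds because \<open>V \<oplus> 1\<close> is unitary when \<open>V\<close> is. The other inclusion rests on the convexity of
  \<open>W\<^sub>A(B)\<close> for \<open>2 \<times> 2\<close> matrices (\<open>convex_rel_num_range_2\<close>).

  Convexity. Unitary similarities of \<open>A\<close> and of \<open>B\<close> do not change \<open>W\<^sub>A(B)\<close>, and every \<open>2 \<times> 2\<close> matrix is
  unitarily similar to one with equal diagonal entries, say with rows \<open>(\<alpha>, x), (y, \<alpha>)\<close> for \<open>A\<close> and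
  \<open>(\<beta>, x'), (y', \<beta>)\<close> for \<open>B\<close>. Then \<open>W\<^sub>A(B)\<close> is the translate by \<open>2 \<alpha> \<beta>\<close> of the set of all
  \<open>y x' p + x y' p\<^sup>* + x x' q + y y' q\<^sup>*\<close>, where \<open>p\<^sup>*\<close> is the conjugate of \<open>p\<close> and \<open>p\<close>, \<open>q\<close> range over the
  complex numbers with \<open>\<bar>p\<bar> + \<bar>q\<bar> = 1\<close>. As the two products \<open>(y x') (x y')\<close> and \<open>(x x') (y y')\<close> coincide, one
  common rotation of the values, together with rotations of \<open>p\<close> and of \<open>q\<close>, turns the two real-linear maps into
  diagonal ones. Their signed semi-axes \<open>m, n\<close> and \<open>M, N\<close> satisfy \<open>M\<^sup>2 - m\<^sup>2 = N\<^sup>2 - n\<^sup>2\<close>. So one of the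
  two filled ellipses contains the other, and an intermediate value argument shows that the set is the larger filled ellipse.

  The padded range. If \<open>V\<close> is a \<open>3 \<times> 3\<close> unitary matrix, its upper left \<open>2 \<times> 2\<close> block \<open>X\<close> has the form
  \<open>U diag(1, \<sigma>) W\<^sup>*\<close> with \<open>U\<close>, \<open>W\<close> unitary and \<open>\<bar>\<sigma>\<bar> \<le> 1\<close> (\<open>corner2_svd\<close>), and the point of the padded range given
  by \<open>V\<close> is \<open>tr(A X B X\<^sup>*)\<close>. Let \<open>U\<^sup>* A U\<close> have rows \<open>(a, b), (c, -a)\<close> and \<open>W\<^sup>* B W\<close> rows \<open>(p, q), (r, t)\<close>. With
  \<open>\<sigma> = s \<rho>\<close>, \<open>s = \<bar>\<sigma>\<bar>\<close>, this point is \<open>a (p - s\<^sup>2 t) + s e\<close> for \<open>e = \<rho> b r + \<rho>\<^sup>* c q\<close>, that is, the convex combination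
  with weights \<open>(1 - s\<^sup>2) / 2\<close> and \<open>(1 + s\<^sup>2) / 2\<close> of \<open>a (p + t)\<close> and \<open>a (p - t) + k e\<close>, where
  \<open>k = 2 s / (1 + s\<^sup>2) \<le> 1\<close>. The second point is in \<open>W\<^sub>A(B)\<close> because \<open>a (p - t) \<plusminus> e\<close> are. The first
  is \<open>a tr B\<close>; the hypothesis on \<open>B\<close> implies that \<open>B\<close> is unitarily similar to a matrix with diagonal \<open>(tr B, 0)\<close>, and
  flipping the sign of its off-diagonal entries gives two points of \<open>W\<^sub>A(B)\<close> with midpoint \<open>a tr B\<close>.
\<close>

section \<open>Sums of two ellipses\<close>

text \<open>The real-linear map of the plane that scales the real axis by \<open>M\<close> and the imaginary axis by \<open>N\<close>.
  The factors may be negative or zero.\<close>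

definition axis_scale :: "real \<Rightarrow> real \<Rightarrow> complex \<Rightarrow> complex" where
  "axis_scale M N q = Complex (M * Re q) (N * Im q)"

lemma linear_axis_scale: "linear (axis_scale M N)"
  by (rule linearI) (auto simp: axis_scale_def complex_eq_iff algebra_simps)

lemma axis_scale_dominated:
  assumes "\<bar>m\<bar> \<le> \<bar>M\<bar>" "\<bar>n\<bar> \<le> \<bar>N\<bar>"
  obtains p' where "cmod p' \<le> cmod p" "axis_scale m n p = axis_scale M N p'"
proof
  \<comment> \<open>If \<open>M = 0\<close> then \<open>m = 0\<close> as well, and the value \<open>m / M = 0\<close> is a correct choice; the same for \<open>N\<close>.\<close>
  define p' where "p' = Complex (m / M * Re p) (n / N * Im p)"
  have "\<bar>m / M\<bar> \<le> 1" "\<bar>n / N\<bar> \<le> 1"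
    using assms by (auto simp: divide_le_eq)
  then have "(m / M * Re p)\<^sup>2 \<le> (Re p)\<^sup>2" "(n / N * Im p)\<^sup>2 \<le> (Im p)\<^sup>2"
    by (metis abs_le_square_iff abs_ge_zero abs_mult mult_left_le_one_le)+
  then show "cmod p' \<le> cmod p"
    by (simp add: cmod_def p'_def)
  show "axis_scale m n p = axis_scale M N p'"
    using assms by (auto simp: axis_scale_def p'_def)
qed

text \<open>The inclusion of the filled ellipse is where the intermediate value theorem enters. Let \<open>u\<close> be a
  point of the unit disc that \<open>axis_scale M N\<close> sends to the point \<open>axis_scale m n 1\<close> of the smaller ellipse. For \<open>q\<close> in
  the unit disc, some \<open>t\<close> in \<open>[0, 1]\<close> makes the modulus of \<open>q - (1 - t) u\<close> exactly \<open>t\<close>.\<close>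

lemma sum_of_axis_scales:
  assumes "\<bar>m\<bar> \<le> \<bar>M\<bar>" "\<bar>n\<bar> \<le> \<bar>N\<bar>"
  shows "{axis_scale m n p + axis_scale M N q | p q. cmod p + cmod q = 1} =
         axis_scale M N ` {q. cmod q \<le> 1}" (is "?S = ?D")
proof
  interpret F: linear "axis_scale M N" by (rule linear_axis_scale)
  interpret G: linear "axis_scale m n" by (rule linear_axis_scale)
  show "?S \<subseteq> ?D"
  proof
    fix w assume "w \<in> ?S"
    then obtain p q where w: "w = axis_scale m n p + axis_scale M N q" and pq: "cmod p + cmod q = 1"
      by auto
    obtain p' where p': "cmod p' \<le> cmod p" "axis_scale m n p = axis_scale M N p'"
      using axis_scale_dominated[OF assms] .
    have "w = axis_scale M N (p' + q)"
      using w p' by (simp add: F.add)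
    moreover have "cmod (p' + q) \<le> 1"
      using norm_triangle_ineq[of p' q] p' pq by simp
    ultimately show "w \<in> ?D" by (auto intro!: imageI)
  qed
  show "?D \<subseteq> ?S"
  proof
    fix w assume "w \<in> ?D"
    then obtain q where w: "w = axis_scale M N q" and q: "cmod q \<le> 1"
      by auto
    obtain u where u: "axis_scale m n 1 = axis_scale M N u"
      using axis_scale_dominated[OF assms] by metis
    define g where "g = (\<lambda>t. cmod (q - (1 - t) *\<^sub>R u) - t)"
    have "\<exists>t. 0 \<le> t \<and> t \<le> 1 \<and> g t = 0"
      by (rule IVT2') (use q in \<open>auto simp: g_def intro!: continuous_intros\<close>)
    then obtain t where t: "0 \<le> t" "t \<le> 1" "g t = 0" by blast
    have "w = axis_scale m n ((1 - t) *\<^sub>R 1) + axis_scale M N (q - (1 - t) *\<^sub>R u)"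
      by (simp add: w F.diff F.scaleR G.scaleR u del: scaleR_one)
    moreover have "cmod ((1 - t) *\<^sub>R 1) + cmod (q - (1 - t) *\<^sub>R u) = 1"
      using t by (simp add: g_def)
    ultimately show "w \<in> ?S" by blast
  qed
qed

lemma convex_unit_disc: "convex {q :: complex. cmod q \<le> 1}"
proof (rule convexI)
  fix x y :: complex and u v :: real
  assume *: "x \<in> {q. cmod q \<le> 1}" "y \<in> {q. cmod q \<le> 1}" "0 \<le> u" "0 \<le> v" "u + v = 1"
  have "cmod (u *\<^sub>R x + v *\<^sub>R y) \<le> u * cmod x + v * cmod y"
    using norm_triangle_ineq[of "u *\<^sub>R x" "v *\<^sub>R y"] * by simp
  also have "\<dots> \<le> u * 1 + v * 1"
    using * by (intro add_mono mult_left_mono) auto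
  finally show "u *\<^sub>R x + v *\<^sub>R y \<in> {q. cmod q \<le> 1}"
    using * by simp
qed

lemma convex_sum_of_axis_scales:
  assumes "M\<^sup>2 - m\<^sup>2 = N\<^sup>2 - n\<^sup>2"
  shows "convex {axis_scale m n p + axis_scale M N q | p q. cmod p + cmod q = 1}" (is "convex ?S")
proof (cases "m\<^sup>2 \<le> M\<^sup>2")
  case True
  then have "\<bar>m\<bar> \<le> \<bar>M\<bar>" "\<bar>n\<bar> \<le> \<bar>N\<bar>"
    using assms by (simp_all add: abs_le_square_iff)
  then show ?thesis
    by (simp only: sum_of_axis_scales)
      (intro convex_linear_image linear_axis_scale convex_unit_disc)
next
  case False
  then have *: "\<bar>M\<bar> \<le> \<bar>m\<bar>" "\<bar>N\<bar> \<le> \<bar>n\<bar>"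
    using assms by (simp_all add: abs_le_square_iff)
  have swap: "{f p + g q | p q. cmod p + cmod q = 1} \<subseteq> {g p + f q | p q. cmod p + cmod q = 1}"
    for f g :: "complex \<Rightarrow> complex"
  proof clarify
    fix p q :: complex
    assume "cmod p + cmod q = 1"
    then show "\<exists>p' q'. f p + g q = g p' + f q' \<and> cmod p' + cmod q' = 1"
      by (intro exI[of _ q] exI[of _ p]) (simp add: add.commute)
  qed
  have "?S = {axis_scale M N p + axis_scale m n q | p q. cmod p + cmod q = 1}"
    by (intro equalityI swap)
  then show ?thesis
    by (simp only: sum_of_axis_scales[OF *])
      (intro convex_linear_image linear_axis_scale convex_unit_disc)
qed

text \<open>Up to a rotation of the argument, \<open>p \<mapsto> a p + b p\<^sup>*\<close> is a diagonal map followed by the rotation by \<open>s\<close>;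
  here \<open>s\<^sup>2\<close> is the phase of \<open>a b\<close>, so that maps with the same product \<open>a b\<close> can share one \<open>s\<close>.\<close>

lemma unimodular_normalise:
  assumes "a * b = s\<^sup>2 * complex_of_real (cmod (a * b))" and s: "cmod s = 1"
  obtains e where "cmod e = 1" "\<And>p. a * p + b * cnj p =
    s * axis_scale (cmod a + cmod b) (cmod a - cmod b) (e * p)"
proof -
  have "\<exists>e. cmod e = 1 \<and> a = s * cmod a * e \<and> b = s * cmod b * cnj e"
  proof (cases "a = 0")
    case True
    show ?thesis
    proof (cases "b = 0")
      case False
      have "cmod (cnj (b / (s * cmod b))) = 1" "b = s * cmod b * cnj (cnj (b / (s * cmod b)))"
        using False s by (auto simp: norm_divide norm_mult)
      with True show ?thesis by (metis mult_zero_left mult_zero_right norm_zero of_real_0)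
    qed (use True in \<open>auto intro: exI[of _ 1]\<close>)
  next
    case False
    define e where "e = a / (s * cmod a)"
    have s0: "s \<noteq> 0" using s by auto
    have e: "cmod e = 1" using False s by (simp add: e_def norm_divide norm_mult)
    then have ee: "e * cnj e = 1" using complex_norm_square[of e] by simp
    have a: "a = s * cmod a * e" using False s0 by (simp add: e_def)
    have "a * b = s * cmod a * (s * cmod b) * (e * cnj e)"
      using assms(1) ee by (simp add: power2_eq_square norm_mult algebra_simps)
    also have "\<dots> = (s * cmod a * e) * (s * cmod b * cnj e)"
      by (simp only: ac_simps)
    finally have "a * b = a * (s * cmod b * cnj e)"
      by (simp only: a[symmetric])
    then have "b = s * cmod b * cnj e"
      using False by (metis mult_left_cancel)
    with a e show ?thesis by blast
  qed
  then obtain e where e: "cmod e = 1" "a = s * cmod a * e" "b = s * cmod b * cnj e" by blast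
  show ?thesis
  proof
    fix p
    have "a * p + b * cnj p = s * (cmod a * (e * p) + cmod b * cnj (e * p))"
      by (subst e(2), subst e(3)) (simp add: algebra_simps)
    also have "cmod a * (e * p) + cmod b * cnj (e * p) =
        axis_scale (cmod a + cmod b) (cmod a - cmod b) (e * p)"
      by (simp add: axis_scale_def complex_eq_iff algebra_simps)
    finally show "a * p + b * cnj p =
       s * axis_scale (cmod a + cmod b) (cmod a - cmod b) (e * p)" .
  qed (fact e(1))
qed

lemma convex_sum_of_ellipses:
  assumes "a * b = c * d"
  shows "convex {a * p + b * cnj p + (c * q + d * cnj q) | p q. cmod p + cmod q = 1}"
    (is "convex ?S")
proof -
  have sq: "sgn z * complex_of_real (cmod z) = z" for z :: complex
    by (cases "z = 0") (auto simp: sgn_eq)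
  obtain s where s: "cmod s = 1" "a * b = s\<^sup>2 * complex_of_real (cmod (a * b))"
  proof (cases "a * b = 0")
    case True then show ?thesis using that[of 1] by auto
  next
    case False
    then have "cmod (csqrt (sgn (a * b))) = 1"
      by (simp add: norm_sgn)
    then show ?thesis using that[of "csqrt (sgn (a * b))"] by (simp only: power2_csqrt sq)
  qed
  obtain e where e: "cmod e = 1" "\<And>p. a * p + b * cnj p =
    s * axis_scale (cmod a + cmod b) (cmod a - cmod b) (e * p)"
    using unimodular_normalise[OF s(2,1)] by metis
  obtain f where f: "cmod f = 1" "\<And>p. c * p + d * cnj p =
    s * axis_scale (cmod c + cmod d) (cmod c - cmod d) (f * p)"
    using unimodular_normalise[OF s(2,1)[unfolded assms]] by metis
  let ?G = "axis_scale (cmod a + cmod b) (cmod a - cmod b)"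
  let ?F = "axis_scale (cmod c + cmod d) (cmod c - cmod d)"
  have inv: "e * (p / e) = p" "f * (p / f) = p" for p
    using e(1) f(1) by auto
  have "?S = (*) s ` {?G p + ?F q | p q. cmod p + cmod q = 1}" (is "_ = _ ` ?T")
  proof (intro equalityI subsetI)
    fix w assume "w \<in> ?S"
    then obtain p q where "w = a * p + b * cnj p + (c * q + d * cnj q)" "cmod p + cmod q = 1"
      by blast
    then have "w = s * (?G (e * p) + ?F (f * q))" "cmod (e * p) + cmod (f * q) = 1"
      using e f by (simp_all only: distrib_left norm_mult mult_1)
    then show "w \<in> (*) s ` ?T" by blast
  next
    fix w assume "w \<in> (*) s ` ?T"
    then obtain p q where "w = s * (?G p + ?F q)" "cmod p + cmod q = 1" by blast
    then have "w = a * (p / e) + b * cnj (p / e) + (c * (q / f) + d * cnj (q / f))"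
      "cmod (p / e) + cmod (q / f) = 1"
      unfolding e(2) f(2) inv using e(1) f(1) by (simp_all add: distrib_left norm_divide)
    then show "w \<in> ?S" by blast
  qed
  moreover have "convex ?T"
  proof (rule convex_sum_of_axis_scales)
    have "cmod a * cmod b = cmod c * cmod d"
      using assms by (metis norm_mult)
    then show "(cmod c + cmod d)\<^sup>2 - (cmod a + cmod b)\<^sup>2 = (cmod c - cmod d)\<^sup>2 - (cmod a - cmod b)\<^sup>2"
      by (simp add: power2_eq_square algebra_simps)
  qed
  moreover have "linear ((*) s)"
    by (rule linearI) (auto simp: algebra_simps)
  ultimately show ?thesis
    by (simp only: convex_linear_image)
qed

section \<open>Traces and unitary similarity\<close>

lemma index_mat_adjoint:
  fixes A :: "complex mat"
  assumes "i < dim_col A" "j < dim_row A"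
  shows "mat_adjoint A $$ (i, j) = cnj (A $$ (j, i))"
  using assms by (simp add: mat_adjoint_def mat_of_rows_index)

lemma dim_mat_adjoint [simp]:
  "dim_row (mat_adjoint A) = dim_col A" "dim_col (mat_adjoint A) = dim_row A"
  by (simp_all add: mat_adjoint_def)

lemma mat_adjoint_carrier [simp, intro]:
  "A \<in> carrier_mat n m \<Longrightarrow> mat_adjoint A \<in> carrier_mat m n"
  by auto

lemma mat_adjoint_adjoint [simp]: "mat_adjoint (mat_adjoint A) = (A :: complex mat)"
  by (rule eq_matI) (auto simp: index_mat_adjoint)

lemma mat_adjoint_mult:
  fixes A :: "complex mat"
  assumes "A \<in> carrier_mat n m" "B \<in> carrier_mat m l"
  shows "mat_adjoint (A * B) = mat_adjoint B * mat_adjoint A"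
  using assms by (intro eq_matI) (auto simp: index_mat_adjoint scalar_prod_def mult.commute)

text \<open>For square matrices of one size the inner dimensions in these two rules are determined,
  so that they can be used for rewriting.\<close>

lemmas square_mult_carrier = mult_carrier_mat[where nr = n and n = n and nc = n for n]
lemmas square_mult_assoc =
  assoc_mult_mat[where ?n\<^sub>1 = n and ?n\<^sub>2 = n and ?n\<^sub>3 = n and ?n\<^sub>4 = n for n]

lemma mat_trace_mult:
  assumes "A \<in> carrier_mat n m" "B \<in> carrier_mat m n"
  shows "mat_trace (A * B) = (\<Sum>i<n. \<Sum>k<m. A $$ (i, k) * B $$ (k, i))"
  using assms by (auto simp: mat_trace_def scalar_prod_def lessThan_atLeast0 intro!: sum.cong)

lemma mat_trace_commute:
  assumes "A \<in> carrier_mat n m" "B \<in> carrier_mat m n"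
  shows "mat_trace (A * B) = mat_trace (B * A)"
  unfolding mat_trace_mult[OF assms] mat_trace_mult[OF assms(2,1)]
  by (subst sum.swap) (simp add: mult.commute)

lemma unitary_matsD:
  assumes "V \<in> unitary_mats n"
  shows "V \<in> carrier_mat n n" "mat_adjoint V * V = 1\<^sub>m n" "V * mat_adjoint V = 1\<^sub>m n"
  using assms by (auto simp: unitary_mats_def)

lemma unitary_mats_adjoint: "V \<in> unitary_mats n \<Longrightarrow> mat_adjoint V \<in> unitary_mats n"
  by (auto simp: unitary_mats_def)

lemma unitary_mats_mult:
  assumes "U \<in> unitary_mats n" "V \<in> unitary_mats n"
  shows "U * V \<in> unitary_mats n"
proof -
  note U = unitary_matsD[OF assms(1)] and V = unitary_matsD[OF assms(2)]
  have "mat_adjoint V * mat_adjoint U * (U * V) = mat_adjoint V * ((mat_adjoint U * U) * V)"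
    using U(1) V(1) by (simp add: square_mult_assoc[of _ n] square_mult_carrier[of _ n])
  also have "\<dots> = 1\<^sub>m n" using U V by simp
  finally have 1: "mat_adjoint V * mat_adjoint U * (U * V) = 1\<^sub>m n" .
  have "U * V * (mat_adjoint V * mat_adjoint U) = U * ((V * mat_adjoint V) * mat_adjoint U)"
    using U(1) V(1) by (simp add: square_mult_assoc[of _ n] square_mult_carrier[of _ n])
  also have "\<dots> = 1\<^sub>m n" using U V by simp
  finally have 2: "U * V * (mat_adjoint V * mat_adjoint U) = 1\<^sub>m n" .
  show ?thesis
    using U(1) V(1) 1 2 by (simp add: unitary_mats_def mat_adjoint_mult[OF U(1) V(1)])
qed

lemma mat_trace_unitary:
  assumes A: "A \<in> carrier_mat n n" and U: "U \<in> unitary_mats n"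
  shows "mat_trace (mat_adjoint U * A * U) = mat_trace A"
proof -
  note U1 = unitary_matsD[OF U]
  have "mat_trace (mat_adjoint U * A * U) = mat_trace (U * (mat_adjoint U * A))"
    using A U1(1) by (intro mat_trace_commute[of _ n n] square_mult_carrier mat_adjoint_carrier)
  also have "U * (mat_adjoint U * A) = (U * mat_adjoint U) * A"
    using A U1(1) by (simp add: square_mult_assoc[of _ n])
  finally show ?thesis using A U1(3) by simp
qed

lemma mat_trace_unitary_conj:
  assumes "A \<in> carrier_mat n n" "B \<in> carrier_mat n n" "V \<in> carrier_mat n n"
    "U \<in> carrier_mat n n" "W \<in> carrier_mat n n"
  shows "mat_trace ((mat_adjoint U * A * U) * (V * (mat_adjoint W * B * W) * mat_adjoint V))
    = mat_trace (A * ((U * V * mat_adjoint W) * B * mat_adjoint (U * V * mat_adjoint W)))"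
proof -
  have "mat_trace ((mat_adjoint U * A * U) * (V * (mat_adjoint W * B * W) * mat_adjoint V))
     = mat_trace (mat_adjoint U * (A * U * (V * (mat_adjoint W * B * W) * mat_adjoint V)))"
    using assms by (simp add: square_mult_assoc[of _ n] square_mult_carrier[of _ n])
  also have "\<dots> = mat_trace ((A * U * (V * (mat_adjoint W * B * W) * mat_adjoint V)) * mat_adjoint U)"
    using assms by (intro mat_trace_commute[of _ n n] square_mult_carrier mat_adjoint_carrier)
  also have "(A * U * (V * (mat_adjoint W * B * W) * mat_adjoint V)) * mat_adjoint U
     = A * ((U * V * mat_adjoint W) * B * mat_adjoint (U * V * mat_adjoint W))"
    using assms by (simp add: square_mult_assoc[of _ n] square_mult_carrier[of _ n]
      mat_adjoint_mult[where n = n and m = n and l = n])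
  finally show ?thesis .
qed

lemma rel_num_rangeI:
  assumes "B \<in> carrier_mat n n" "V \<in> unitary_mats n"
  shows "mat_trace (A * (V * B * mat_adjoint V)) \<in> rel_num_range A B"
  using assms unfolding rel_num_range_def by blast

lemma rel_num_rangeE:
  assumes "z \<in> rel_num_range A B" "B \<in> carrier_mat n n"
  obtains V where "V \<in> unitary_mats n" "z = mat_trace (A * (V * B * mat_adjoint V))"
  using assms unfolding rel_num_range_def by blast

lemma rel_num_range_unitary_conj:
  assumes A: "A \<in> carrier_mat n n" and B: "B \<in> carrier_mat n n"
    and U': "U \<in> unitary_mats n" and W': "W \<in> unitary_mats n"
  shows "rel_num_range (mat_adjoint U * A * U) (mat_adjoint W * B * W) = rel_num_range A B"
proof -
  note U = unitary_matsD[OF U'] and W = unitary_matsD[OF W']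
  have B': "mat_adjoint W * B * W \<in> carrier_mat n n"
    using B W(1) by (intro square_mult_carrier mat_adjoint_carrier)
  show ?thesis
  proof (intro equalityI subsetI)
    fix z assume "z \<in> rel_num_range (mat_adjoint U * A * U) (mat_adjoint W * B * W)"
    then obtain V where V: "V \<in> unitary_mats n" and
      z: "z = mat_trace ((mat_adjoint U * A * U) * (V * (mat_adjoint W * B * W) * mat_adjoint V))"
      using B' by (rule rel_num_rangeE)
    have "U * V * mat_adjoint W \<in> unitary_mats n"
      using U' W' V by (intro unitary_mats_mult unitary_mats_adjoint)
    then show "z \<in> rel_num_range A B"
      unfolding z mat_trace_unitary_conj[OF A B unitary_matsD(1)[OF V] U(1) W(1)]
      by (rule rel_num_rangeI[OF B])
  next
    fix z assume "z \<in> rel_num_range A B"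
    then obtain V where V: "V \<in> unitary_mats n" and z: "z = mat_trace (A * (V * B * mat_adjoint V))"
      using B by (rule rel_num_rangeE)
    let ?V = "mat_adjoint U * V * W"
    note V1 = unitary_matsD(1)[OF V]
    have V': "?V \<in> unitary_mats n"
      using U' W' V by (intro unitary_mats_mult unitary_mats_adjoint)
    have "U * ?V = (U * mat_adjoint U) * (V * W)"
      using U(1) W(1) V1 by (simp add: square_mult_assoc[of _ n] square_mult_carrier[of _ n])
    also have "\<dots> = V * W"
      using U(1,3) W(1) V1 by (simp add: square_mult_carrier[of _ n])
    finally have "U * ?V * mat_adjoint W = V * W * mat_adjoint W" by simp
    also have "\<dots> = V"
      using W(1,3) V1 by (simp add: square_mult_assoc[of _ n] square_mult_carrier[of _ n])
    finally have "U * ?V * mat_adjoint W = V" .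
    with z have "z = mat_trace ((mat_adjoint U * A * U) * (?V * (mat_adjoint W * B * W) * mat_adjoint ?V))"
      using mat_trace_unitary_conj[OF A B unitary_matsD(1)[OF V'] U(1) W(1)] by simp
    also have "\<dots> \<in> rel_num_range (mat_adjoint U * A * U) (mat_adjoint W * B * W)"
      by (rule rel_num_rangeI[OF B' V'])
    finally show "z \<in> rel_num_range (mat_adjoint U * A * U) (mat_adjoint W * B * W)" .
  qed
qed

section \<open>Unitary matrices of order two\<close>

text \<open>The \<open>2 \<times> 2\<close> matrix with rows \<open>(a, b)\<close> and \<open>(c, d)\<close>.\<close>

definition mat2 :: "'a \<Rightarrow> 'a \<Rightarrow> 'a \<Rightarrow> 'a \<Rightarrow> 'a mat" where
  "mat2 a b c d =
    mat 2 2 (\<lambda>(i, j). if i = 0 then (if j = 0 then a else b) else (if j = 0 then c else d))"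

lemma mat2_carrier [simp, intro]: "mat2 a b c d \<in> carrier_mat 2 2"
  by (simp add: mat2_def)

lemma dim_mat2 [simp]: "dim_row (mat2 a b c d) = 2" "dim_col (mat2 a b c d) = 2"
  by (simp_all add: mat2_def)

lemma index_mat2 [simp]:
  "mat2 a b c d $$ (0, 0) = a" "mat2 a b c d $$ (0, Suc 0) = b"
  "mat2 a b c d $$ (Suc 0, 0) = c" "mat2 a b c d $$ (Suc 0, Suc 0) = d"
  by (simp_all add: mat2_def)

lemma mat2_eqI:
  assumes "A \<in> carrier_mat 2 2" "B \<in> carrier_mat 2 2"
    "A $$ (0, 0) = B $$ (0, 0)" "A $$ (0, Suc 0) = B $$ (0, Suc 0)"
    "A $$ (Suc 0, 0) = B $$ (Suc 0, 0)" "A $$ (Suc 0, Suc 0) = B $$ (Suc 0, Suc 0)"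
  shows "A = B"
  using assms by (intro eq_matI) (auto simp: less_2_cases_iff)

lemma mat2_entries:
  "A \<in> carrier_mat 2 2 \<Longrightarrow> A = mat2 (A $$ (0, 0)) (A $$ (0, Suc 0)) (A $$ (Suc 0, 0)) (A $$ (Suc 0, Suc 0))"
  by (rule mat2_eqI) auto

lemma mat2_eq_iff: "mat2 a b c d = mat2 a' b' c' d' \<longleftrightarrow> a = a' \<and> b = b' \<and> c = c' \<and> d = d'"
  by (metis index_mat2)

lemma one_mat2: "1\<^sub>m 2 = mat2 1 0 0 1"
  by (rule mat2_eqI) auto

lemma mat2_mult:
  "mat2 a b c d * mat2 a' b' c' d' =
   mat2 (a * a' + b * c') (a * b' + b * d') (c * a' + d * c') (c * b' + d * d' :: 'a :: comm_semiring_0)"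
  by (rule mat2_eqI) (auto simp: scalar_prod_def numeral_2_eq_2)

lemma mat2_adjoint: "mat_adjoint (mat2 a b c d) = mat2 (cnj a) (cnj c) (cnj b) (cnj d)"
  by (rule mat2_eqI) (auto simp: index_mat_adjoint)

lemma mat_trace_mat2: "mat_trace (mat2 a b c d) = a + d"
  by (simp add: mat_trace_def numeral_2_eq_2)

lemma mat2_unitary_iff:
  "mat2 a b c d \<in> unitary_mats 2 \<longleftrightarrow>
     (a * cnj a + c * cnj c = 1 \<and> cnj a * b + cnj c * d = 0 \<and> b * cnj b + d * cnj d = 1) \<and>
     (a * cnj a + b * cnj b = 1 \<and> a * cnj c + b * cnj d = 0 \<and> c * cnj c + d * cnj d = 1)"
proof -
  have "cnj b * a + cnj d * c = 0 \<longleftrightarrow> cnj a * b + cnj c * d = 0"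
    using complex_cnj_cancel_iff[of "cnj b * a + cnj d * c" 0] by (simp add: mult.commute)
  moreover have "c * cnj a + d * cnj b = 0 \<longleftrightarrow> a * cnj c + b * cnj d = 0"
    using complex_cnj_cancel_iff[of "c * cnj a + d * cnj b" 0] by (simp add: mult.commute)
  ultimately show ?thesis
    unfolding unitary_mats_def
    by (auto simp: mat2_mult mat2_adjoint one_mat2 mat2_eq_iff mult.commute)
qed

lemma unit_vector_unitary:
  assumes "v * cnj v + w * cnj w = 1"
  shows "mat2 v (- cnj w) w (cnj v) \<in> unitary_mats 2"
  using assms by (auto simp: mat2_unitary_iff algebra_simps)

text \<open>A unit vector \<open>x = (v, w)\<close> is completed to a unitary matrix with first column \<open>x\<close>. The first entry of the
  conjugated matrix is \<open>x\<^sup>* M x\<close> for the given matrix \<open>M\<close>, and the trace fixes the last entry.\<close>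

lemma unitary_conj_first_entry:
  assumes unit: "v * cnj v + w * cnj w = 1"
  obtains U q r where "U \<in> unitary_mats 2"
    "mat_adjoint U * mat2 a b c d * U =
      mat2 (a * (v * cnj v) + b * (cnj v * w) + c * (v * cnj w) + d * (w * cnj w)) q r
       (a + d - (a * (v * cnj v) + b * (cnj v * w) + c * (v * cnj w) + d * (w * cnj w)))"
proof
  let ?U = "mat2 v (- cnj w) w (cnj v)"
  let ?M = "mat_adjoint ?U * mat2 a b c d * ?U"
  show "?U \<in> unitary_mats 2" by (rule unit_vector_unitary[OF unit])
  have "a + d - (a * (v * cnj v) + b * (cnj v * w) + c * (v * cnj w) + d * (w * cnj w))
    = (a + d) * (v * cnj v + w * cnj w) - (a * (v * cnj v) + b * (cnj v * w) + c * (v * cnj w) + d * (w * cnj w))"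
    by (simp add: unit)
  also have "\<dots> = a * (w * cnj w) - b * (cnj v * w) - c * (v * cnj w) + d * (v * cnj v)"
    by (simp add: algebra_simps)
  finally show "?M =
      mat2 (a * (v * cnj v) + b * (cnj v * w) + c * (v * cnj w) + d * (w * cnj w))
         (?M $$ (0, Suc 0)) (?M $$ (Suc 0, 0))
       (a + d - (a * (v * cnj v) + b * (cnj v * w) + c * (v * cnj w) + d * (w * cnj w)))"
    unfolding mat2_adjoint mat2_mult mat2_eq_iff index_mat2
    by (simp add: algebra_simps)
qed

text \<open>The matrix with rows \<open>(a, b), (c, -a)\<close> has a unit vector \<open>x = (v, w)\<close> with \<open>x\<^sup>* M x = 0\<close>. For \<open>w = r \<zeta> v\<close> with
  \<open>\<bar>\<zeta>\<bar> = 1\<close> and real \<open>r\<close>, after division by \<open>a\<close>, the equation is \<open>1 - r\<^sup>2 + r (\<beta> \<zeta> + \<gamma> \<zeta>\<^sup>*) = 0\<close>. The phase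
  \<open>\<zeta>\<close> is chosen to make \<open>k = \<beta> \<zeta> + \<gamma> \<zeta>\<^sup>*\<close> real, which leaves a real quadratic equation for \<open>r\<close>.\<close>

lemma isotropic_unit_vector:
  fixes a b c :: complex
  obtains v w where "v * cnj v + w * cnj w = 1"
    "a * (v * cnj v - w * cnj w) + b * (cnj v * w) + c * (v * cnj w) = 0"
proof (cases "a = 0")
  case True
  then show ?thesis using that[of 1 0] by auto
next
  case False
  define \<beta> \<gamma> where "\<beta> = b / a" "\<gamma> = c / a"
  have bc: "b = a * \<beta>" "c = a * \<gamma>" using False by (simp_all add: \<beta>_\<gamma>_def)
  define \<delta> where "\<delta> = \<beta> - cnj \<gamma>"
  obtain \<zeta> where z: "cmod \<zeta> = 1" "Im (\<delta> * \<zeta>) = 0"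
  proof (cases "\<delta> = 0")
    case True then show ?thesis using that[of 1] by auto
  next
    case False
    have "\<delta> * cnj (sgn \<delta>) = cmod \<delta>"
      using False complex_norm_square[of \<delta>] by (simp add: sgn_eq power2_eq_square divide_simps)
    then show ?thesis using that[of "cnj (sgn \<delta>)"] False by (simp add: norm_sgn)
  qed
  define k where "k = Re (\<beta> * \<zeta> + \<gamma> * cnj \<zeta>)"
  have "Im (\<beta> * \<zeta> + \<gamma> * cnj \<zeta>) = Im (\<delta> * \<zeta>)"
    by (simp add: \<delta>_def algebra_simps)
  then have k: "\<beta> * \<zeta> + \<gamma> * cnj \<zeta> = of_real k"
    using z by (simp add: k_def complex_eq_iff)
  define r where "r = (k + sqrt (k\<^sup>2 + 4)) / 2"
  have r: "r * r = k * r + 1"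
  proof -
    have "sqrt (k\<^sup>2 + 4) * sqrt (k\<^sup>2 + 4) = k\<^sup>2 + 4" by simp
    then show ?thesis by (simp add: r_def field_simps power2_eq_square)
  qed
  define n where "n = sqrt (1 + r * r)"
  have n: "n * n = 1 + r * r" "n \<noteq> 0"
    by (auto simp: n_def add_nonneg_eq_0_iff)
  have zz: "\<zeta> * cnj \<zeta> = 1" using z complex_norm_square[of \<zeta>] by simp
  let ?v = "complex_of_real (1 / n)" and ?w = "of_real (r / n) * \<zeta>"
  have vv: "?v * cnj ?v = of_real (1 / (n * n))" by simp
  have "?w * cnj ?w = of_real (r * r / (n * n)) * (\<zeta> * cnj \<zeta>)" by simp
  then have ww: "?w * cnj ?w = of_real (r * r / (n * n))" using zz by simp
  show ?thesis
  proof
    have "1 / (n * n) + r * r / (n * n) = 1"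
      using n(2) by (simp flip: add_divide_distrib n(1))
    then show "?v * cnj ?v + ?w * cnj ?w = 1"
      unfolding vv ww by (metis of_real_add of_real_1)
    have "a * (?v * cnj ?v - ?w * cnj ?w) + b * (cnj ?v * ?w) + c * (?v * cnj ?w)
      = a * (of_real (1 / (n * n)) - of_real (r * r / (n * n))
          + of_real (r / (n * n)) * (\<beta> * \<zeta> + \<gamma> * cnj \<zeta>))"
      unfolding vv ww bc by (simp add: algebra_simps add_divide_distrib)
    also have "\<dots> = a * of_real (1 / (n * n) - r * r / (n * n) + r / (n * n) * k)"
      unfolding k by simp
    also have "1 / (n * n) - r * r / (n * n) + r / (n * n) * k = 0"
      using r n(2) by (simp add: divide_simps)
    finally show "a * (?v * cnj ?v - ?w * cnj ?w) + b * (cnj ?v * ?w) + c * (?v * cnj ?w) = 0"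
      by simp
  qed
qed

lemma unitary_conj_equal_diagonal:
  assumes "A \<in> carrier_mat 2 2"
  obtains U \<alpha> x y where "U \<in> unitary_mats 2" "mat_adjoint U * A * U = mat2 \<alpha> x y \<alpha>"
proof -
  obtain a b c d where A: "A = mat2 a b c d"
    using mat2_entries[OF assms] by blast
  obtain v w where unit: "v * cnj v + w * cnj w = 1" and
    iso: "(a - d) / 2 * (v * cnj v - w * cnj w) + b * (cnj v * w) + c * (v * cnj w) = 0"
    using isotropic_unit_vector .
  have "a * (v * cnj v) + b * (cnj v * w) + c * (v * cnj w) + d * (w * cnj w)
    = ((a - d) / 2 * (v * cnj v - w * cnj w) + b * (cnj v * w) + c * (v * cnj w))
      + (a + d) / 2 * (v * cnj v + w * cnj w)"
    by (simp add: field_simps)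
  then have *: "a * (v * cnj v) + b * (cnj v * w) + c * (v * cnj w) + d * (w * cnj w) = (a + d) / 2"
    unfolding iso unit by simp
  have **: "a + d - (a + d) / 2 = (a + d) / 2" by (simp add: field_simps)
  obtain U q r where "U \<in> unitary_mats 2" "mat_adjoint U * A * U = mat2 ((a + d) / 2) q r ((a + d) / 2)"
    using unitary_conj_first_entry[OF unit, of a b c d, folded A] unfolding * ** .
  then show thesis using that by blast
qed

lemma unitary2_abs:
  assumes "mat2 a b c d \<in> unitary_mats 2"
  shows "cmod a = cmod d" "cmod b = cmod c" "(cmod a)\<^sup>2 + (cmod b)\<^sup>2 = 1"
proof -
  have *: "complex_of_real ((cmod a)\<^sup>2 + (cmod b)\<^sup>2) = 1" "complex_of_real ((cmod a)\<^sup>2 + (cmod c)\<^sup>2) = 1"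
    "complex_of_real ((cmod b)\<^sup>2 + (cmod d)\<^sup>2) = 1"
    using assms unfolding mat2_unitary_iff by (simp_all add: complex_norm_square[symmetric] del: of_real_power)
  then have "(cmod a)\<^sup>2 + (cmod b)\<^sup>2 = 1" "(cmod a)\<^sup>2 + (cmod c)\<^sup>2 = 1" "(cmod b)\<^sup>2 + (cmod d)\<^sup>2 = 1"
    by (simp_all only: of_real_eq_1_iff)
  then have "(cmod a)\<^sup>2 = (cmod d)\<^sup>2" "(cmod b)\<^sup>2 = (cmod c)\<^sup>2" "(cmod a)\<^sup>2 + (cmod b)\<^sup>2 = 1" by linarith+
  then show "cmod a = cmod d" "cmod b = cmod c" "(cmod a)\<^sup>2 + (cmod b)\<^sup>2 = 1"
    by (simp_all add: power2_eq_iff_nonneg)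
qed

section \<open>Convexity for matrices of order two\<close>

text \<open>For a unitary \<open>V\<close> with rows \<open>(a, b), (c, d)\<close>, the parameters are \<open>p = a d\<^sup>*\<close> and \<open>q = c b\<^sup>*\<close>. Since
  \<open>\<bar>a\<bar> = \<bar>d\<bar>\<close> and \<open>\<bar>b\<bar> = \<bar>c\<bar>\<close>, they satisfy \<open>\<bar>p\<bar> + \<bar>q\<bar> = \<bar>a\<bar>\<^sup>2 + \<bar>b\<bar>\<^sup>2 = 1\<close>.\<close>

lemma rel_num_range_equal_diagonal:
  "rel_num_range (mat2 \<alpha> x y \<alpha>) (mat2 \<beta> x' y' \<beta>) =
   (\<lambda>z. 2 * \<alpha> * \<beta> + z) `
     {y * x' * p + x * y' * cnj p + (x * x' * q + y * y' * cnj q) | p q. cmod p + cmod q = 1}"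
   (is "?W = ?f ` ?S")
proof -
  have val: "mat_trace (mat2 \<alpha> x y \<alpha> * (V * mat2 \<beta> x' y' \<beta> * mat_adjoint V)) =
     ?f (y * x' * p + x * y' * cnj p + (x * x' * q + y * y' * cnj q))"
    if V: "V = mat2 a b c d" "V \<in> unitary_mats 2" and pq: "p = a * cnj d" "q = c * cnj b" for V a b c d p q
  proof -
    have "mat_trace (mat2 \<alpha> x y \<alpha> * (V * mat2 \<beta> x' y' \<beta> * mat_adjoint V)) =
       \<alpha> * \<beta> * ((a * cnj a + b * cnj b) + (c * cnj c + d * cnj d))
       + \<alpha> * (x' * cnj (cnj a * b + cnj c * d) + y' * (cnj a * b + cnj c * d))
       + \<beta> * (y * (a * cnj c + b * cnj d) + x * cnj (a * cnj c + b * cnj d))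
       + (y * x' * p + x * y' * cnj p + (x * x' * q + y * y' * cnj q))"
      unfolding V(1) mat2_adjoint mat2_mult mat_trace_mat2 pq by (simp add: algebra_simps)
    moreover have "a * cnj a + b * cnj b = 1" "c * cnj c + d * cnj d = 1"
      "cnj a * b + cnj c * d = 0" "a * cnj c + b * cnj d = 0"
      using V unfolding V(1) mat2_unitary_iff by blast+
    ultimately show ?thesis by simp
  qed
  show ?thesis
  proof (intro equalityI subsetI)
    fix z assume "z \<in> ?W"
    then obtain V where V: "V \<in> unitary_mats 2"
      "z = mat_trace (mat2 \<alpha> x y \<alpha> * (V * mat2 \<beta> x' y' \<beta> * mat_adjoint V))"
      by (auto simp: rel_num_range_def)
    obtain a b c d where V': "V = mat2 a b c d"
      using mat2_entries[OF unitary_matsD(1)[OF V(1)]] by blast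
    have "cmod (a * cnj d) + cmod (c * cnj b) = 1"
      using unitary2_abs[OF V(1)[unfolded V']] by (simp add: norm_mult power2_eq_square)
    with val[OF V' V(1) refl refl] V(2) show "z \<in> ?f ` ?S" by blast
  next
    fix z assume "z \<in> ?f ` ?S"
    then obtain p q where z: "z = ?f (y * x' * p + x * y' * cnj p + (x * x' * q + y * y' * cnj q))"
      and pq: "cmod p + cmod q = 1" by blast
    \<comment> \<open>For \<open>d = a\<^sup>*\<close> and \<open>b = - c\<^sup>*\<close> the parameters are \<open>p = a\<^sup>2\<close> and \<open>q = - c\<^sup>2\<close>.\<close>
    define V where "V = mat2 (csqrt p) (- cnj (csqrt (- q))) (csqrt (- q)) (cnj (csqrt p))"
    have "complex_of_real ((cmod (csqrt p))\<^sup>2 + (cmod (csqrt (- q)))\<^sup>2) = 1"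
      using pq by (simp flip: norm_power)
    then have V: "V \<in> unitary_mats 2"
      unfolding V_def by (intro unit_vector_unitary) (simp only: of_real_add complex_norm_square)
    have "p = csqrt p * cnj (cnj (csqrt p))" "q = csqrt (- q) * cnj (- cnj (csqrt (- q)))"
      using power2_csqrt[of p] power2_csqrt[of "- q"] by (simp_all add: power2_eq_square)
    from val[OF V_def V this] z show "z \<in> ?W"
      using rel_num_rangeI[OF mat2_carrier V, of "mat2 \<alpha> x y \<alpha>"] by metis
  qed
qed

theorem convex_rel_num_range_2:
  assumes "A \<in> carrier_mat 2 2" "B \<in> carrier_mat 2 2"
  shows "convex (rel_num_range A B)"
proof -
  obtain U \<alpha> x y where U: "U \<in> unitary_mats 2" "mat_adjoint U * A * U = mat2 \<alpha> x y \<alpha>"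
    using unitary_conj_equal_diagonal[OF assms(1)] .
  obtain W \<beta> x' y' where W: "W \<in> unitary_mats 2" "mat_adjoint W * B * W = mat2 \<beta> x' y' \<beta>"
    using unitary_conj_equal_diagonal[OF assms(2)] .
  have "rel_num_range A B = rel_num_range (mat2 \<alpha> x y \<alpha>) (mat2 \<beta> x' y' \<beta>)"
    using rel_num_range_unitary_conj[OF assms U(1) W(1)] unfolding U(2) W(2) by simp
  then show ?thesis
    unfolding rel_num_range_equal_diagonal
    by (auto intro!: convex_translation convex_sum_of_ellipses)
qed

section \<open>The upper left block of a unitary matrix of order three\<close>

lemma pad_zero_carrier: "X \<in> carrier_mat 2 2 \<Longrightarrow> pad_zero X \<in> carrier_mat 3 3"
  by (auto simp: pad_zero_def Let_def)

lemma index_pad_zero: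
  assumes "X \<in> carrier_mat 2 2" "i < 3" "j < 3"
  shows "pad_zero X $$ (i, j) = (if i < 2 \<and> j < 2 then X $$ (i, j) else 0)"
  using assms by (auto simp: pad_zero_def Let_def)

text \<open>The upper left \<open>2 \<times> 2\<close> block.\<close>

definition corner2 :: "'a mat \<Rightarrow> 'a mat" where
  "corner2 V = mat2 (V $$ (0, 0)) (V $$ (0, 1)) (V $$ (1, 0)) (V $$ (1, 1))"

lemma mat_trace_conj_sum:
  assumes "A \<in> carrier_mat n n" "B \<in> carrier_mat n n" "V \<in> carrier_mat n n"
  shows "mat_trace (A * (V * B * mat_adjoint V)) =
    (\<Sum>i<n. \<Sum>j<n. \<Sum>k<n. \<Sum>l<n. A $$ (i, j) * (V $$ (j, l) * B $$ (l, k) * cnj (V $$ (i, k))))"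
proof -
  have VB: "(V * B * mat_adjoint V) $$ (j, i) = (\<Sum>k<n. \<Sum>l<n. V $$ (j, l) * B $$ (l, k) * cnj (V $$ (i, k)))"
    if "i < n" "j < n" for i j
    using assms that
    by (auto simp: scalar_prod_def lessThan_atLeast0 index_mat_adjoint sum_distrib_right intro!: sum.cong)
  have "V * B * mat_adjoint V \<in> carrier_mat n n"
    using assms by (intro square_mult_carrier mat_adjoint_carrier)
  then show ?thesis
    by (simp add: mat_trace_mult[OF assms(1)] VB sum_distrib_left)
qed

lemma mat_trace_pad_zero:
  assumes A: "A \<in> carrier_mat 2 2" and B: "B \<in> carrier_mat 2 2" and V: "V \<in> carrier_mat 3 3"
  shows "mat_trace (pad_zero A * (V * pad_zero B * mat_adjoint V)) =
    mat_trace (A * (corner2 V * B * mat_adjoint (corner2 V)))"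
proof -
  have c: "corner2 V \<in> carrier_mat 2 2" by (simp add: corner2_def)
  have sums: "(\<Sum>i<3. f i) = f 0 + f 1 + f 2" "(\<Sum>i<2. f i) = f 0 + f 1" for f :: "nat \<Rightarrow> complex"
    by (simp_all add: numeral_3_eq_3 numeral_2_eq_2)
  have pad: "pad_zero X $$ (0, 0) = X $$ (0, 0)" "pad_zero X $$ (0, 1) = X $$ (0, 1)"
    "pad_zero X $$ (1, 0) = X $$ (1, 0)" "pad_zero X $$ (1, 1) = X $$ (1, 1)"
    "pad_zero X $$ (0, 2) = 0" "pad_zero X $$ (1, 2) = 0" "pad_zero X $$ (2, 0) = 0"
    "pad_zero X $$ (2, 1) = 0" "pad_zero X $$ (2, 2) = 0"
    if "X \<in> carrier_mat 2 2" for X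
    using that by (simp_all add: index_pad_zero)
  have corner: "corner2 V $$ (0, 0) = V $$ (0, 0)" "corner2 V $$ (0, 1) = V $$ (0, 1)"
    "corner2 V $$ (1, 0) = V $$ (1, 0)" "corner2 V $$ (1, 1) = V $$ (1, 1)"
    by (simp_all add: corner2_def)
  show ?thesis
    unfolding mat_trace_conj_sum[OF pad_zero_carrier[OF A] pad_zero_carrier[OF B] V] mat_trace_conj_sum[OF A B c]
    by (simp only: sums pad[OF A] pad[OF B] corner mult_zero_left mult_zero_right add_0_left add_0_right)
qed

lemma index_adjoint_mult:
  fixes V :: "complex mat"
  assumes "V \<in> carrier_mat n n" "i < n" "j < n"
  shows "(mat_adjoint V * V) $$ (i, j) = (\<Sum>k<n. cnj (V $$ (k, i)) * V $$ (k, j))"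
  using assms by (auto simp: scalar_prod_def index_mat_adjoint lessThan_atLeast0 intro!: sum.cong)

lemma corner2_extension:
  assumes "V \<in> unitary_mats 2"
  obtains V' where "V' \<in> unitary_mats 3" "corner2 V' = V"
proof
  obtain a b c d where V: "V = mat2 a b c d"
    using mat2_entries[OF unitary_matsD(1)[OF assms]] by blast
  note eqs = assms[unfolded V mat2_unitary_iff]
  define V' where "V' = mat 3 3 (\<lambda>(i, j). if i < 2 \<and> j < 2 then V $$ (i, j) else if i = j then 1 else 0)"
  have carrier: "V' \<in> carrier_mat 3 3" by (simp add: V'_def)
  have entries: "V' $$ (0, 0) = a" "V' $$ (0, 1) = b" "V' $$ (1, 0) = c" "V' $$ (1, 1) = d"
    "V' $$ (0, 2) = 0" "V' $$ (1, 2) = 0" "V' $$ (2, 0) = 0" "V' $$ (2, 1) = 0" "V' $$ (2, 2) = 1"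
    by (simp_all add: V'_def V)
  have sum3: "(\<Sum>k<3. f k) = f 0 + f 1 + f 2" for f :: "nat \<Rightarrow> complex"
    by (simp add: numeral_3_eq_3 numeral_2_eq_2)
  have orth: "cnj b * a + cnj d * c = 0"
    using eqs complex_cnj_cancel_iff[of "cnj b * a + cnj d * c" 0] by (simp add: mult.commute)
  have "mat_adjoint V' * V' = 1\<^sub>m 3"
  proof (rule eq_matI)
    fix i j assume "i < dim_row (1\<^sub>m 3 :: complex mat)" "j < dim_col (1\<^sub>m 3 :: complex mat)"
    then have ij: "i < 3" "j < 3" by simp_all
    then have "i = 0 \<or> i = 1 \<or> i = 2" "j = 0 \<or> j = 1 \<or> j = 2" by linarith+
    then have "(\<Sum>k<3. cnj (V' $$ (k, i)) * V' $$ (k, j)) = (if i = j then 1 else 0)"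
      unfolding sum3 using eqs orth by (elim disjE) (simp_all add: entries entries[simplified] mult.commute)
    then show "(mat_adjoint V' * V') $$ (i, j) = 1\<^sub>m 3 $$ (i, j)"
      using ij by (simp only: index_adjoint_mult[OF carrier]) simp
  qed (use carrier in auto)
  moreover from this have "V' * mat_adjoint V' = 1\<^sub>m 3"
    using mat_mult_left_right_inverse carrier mat_adjoint_carrier by blast
  ultimately show "V' \<in> unitary_mats 3" using carrier by (simp add: unitary_mats_def)
  show "corner2 V' = V" by (simp only: corner2_def entries V)
qed

text \<open>Multiplication by \<open>V\<close> preserves inner products of the vectors \<open>(u, u', 0)\<close> and \<open>(w, w', 0)\<close>; the third component
  of the images is moved to the right-hand side.\<close>

lemma corner2_gram:
  assumes V: "V \<in> unitary_mats 3"
  defines "ip \<equiv> (\<lambda>i u u'. V $$ (i, 0) * u + V $$ (i, 1) * u')"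
  shows "cnj (ip 0 u u') * ip 0 w w' + cnj (ip 1 u u') * ip 1 w w' =
    cnj u * w + cnj u' * w' - cnj (ip 2 u u') * ip 2 w w'"
proof -
  have G: "(\<Sum>k<3. cnj (V $$ (k, i)) * V $$ (k, j)) = (if i = j then 1 else 0)"
    if "i < 3" "j < 3" for i j
  proof -
    show ?thesis
      using unitary_matsD(2)[OF V] that index_adjoint_mult[OF unitary_matsD(1)[OF V] that] by simp
  qed
  have "cnj (ip 0 u u') * ip 0 w w' + cnj (ip 1 u u') * ip 1 w w' + cnj (ip 2 u u') * ip 2 w w' =
     cnj u * w * (\<Sum>k<3. cnj (V $$ (k, 0)) * V $$ (k, 0)) + cnj u * w' * (\<Sum>k<3. cnj (V $$ (k, 0)) * V $$ (k, 1))
   + cnj u' * w * (\<Sum>k<3. cnj (V $$ (k, 1)) * V $$ (k, 0)) + cnj u' * w' * (\<Sum>k<3. cnj (V $$ (k, 1)) * V $$ (k, 1))"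
    by (simp add: ip_def numeral_3_eq_3 algebra_simps numeral_2_eq_2)
  also have "\<dots> = cnj u * w + cnj u' * w'"
    by (simp add: G)
  finally show ?thesis by (simp add: algebra_simps)
qed

text \<open>Some unit vector \<open>x = (v, w)\<close> is annihilated by the first two entries of the third row of \<open>V\<close>. So the block
  \<open>X = corner2 V\<close> maps \<open>x\<close> to a unit vector \<open>y\<close>, and it maps the orthogonal complement of \<open>x\<close> into that of \<open>y\<close>. These
  two orthonormal bases diagonalise \<open>X\<close>.\<close>

lemma corner2_svd:
  assumes V: "V \<in> unitary_mats 3"
  obtains U W \<sigma> where "U \<in> unitary_mats 2" "W \<in> unitary_mats 2" "cmod \<sigma> \<le> 1"
    "corner2 V = U * mat2 1 0 0 \<sigma> * mat_adjoint W"
proof -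
  let ?row = "\<lambda>i u u'. V $$ (i, 0) * u + V $$ (i, 1) * u'"
  obtain v w where unit: "v * cnj v + w * cnj w = 1" and perp: "?row 2 v w = 0"
  proof -
    define g h where "g = V $$ (2, 0)" "h = V $$ (2, 1)"
    define n where "n = sqrt ((cmod g)\<^sup>2 + (cmod h)\<^sup>2)"
    show thesis
    proof (cases "n = 0")
      case True
      then have "g = 0" "h = 0" by (simp_all add: n_def sum_power2_eq_zero_iff)
      then show thesis using that[of 1 0] by (simp add: g_h_def)
    next
      case False
      have "n * n = (cmod h)\<^sup>2 + (cmod g)\<^sup>2"
        by (simp add: n_def)
      then have nn: "of_real (n * n) = h * cnj h + g * cnj g"
        by (simp only: of_real_add complex_norm_square)
      have "h / n * cnj (h / n) + - g / n * cnj (- g / n) = (h * cnj h + g * cnj g) / of_real (n * n)"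
        by (simp add: add_divide_distrib)
      also have "\<dots> = 1"
        unfolding nn[symmetric] using False by simp
      finally have "h / n * cnj (h / n) + - g / n * cnj (- g / n) = 1" .
      moreover have "g * (h / n) + h * (- g / n) = 0" by simp
      ultimately show thesis using that unfolding g_h_def by blast
    qed
  qed
  let ?W = "mat2 v (- cnj w) w (cnj v)"
  have W: "?W \<in> unitary_mats 2" by (rule unit_vector_unitary[OF unit])
  define y0 y1 where "y0 = ?row 0 v w" "y1 = ?row 1 v w"
  define z0 z1 where "z0 = ?row 0 (- cnj w) (cnj v)" "z1 = ?row 1 (- cnj w) (cnj v)"
  have XW: "corner2 V * ?W = mat2 y0 z0 y1 z1"
    unfolding corner2_def mat2_mult y0_y1_def z0_z1_def ..
  have yy: "y0 * cnj y0 + y1 * cnj y1 = 1"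
    using corner2_gram[OF V, of v w v w] unit unfolding perp y0_y1_def by (simp add: mult.commute)
  have yz: "cnj y0 * z0 + cnj y1 * z1 = 0"
    using corner2_gram[OF V, of v w "- cnj w" "cnj v"] unfolding perp y0_y1_def z0_z1_def by (simp add: mult.commute)
  have zz: "(cmod z0)\<^sup>2 + (cmod z1)\<^sup>2 \<le> 1"
  proof -
    let ?t = "?row 2 (- cnj w) (cnj v)"
    have "z0 * cnj z0 + z1 * cnj z1 = (v * cnj v + w * cnj w) - ?t * cnj ?t"
      using corner2_gram[OF V, of "- cnj w" "cnj v" "- cnj w" "cnj v"]
      unfolding z0_z1_def by (simp add: mult.commute add.commute)
    then have "complex_of_real ((cmod z0)\<^sup>2 + (cmod z1)\<^sup>2) = of_real (1 - (cmod ?t)\<^sup>2)"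
      unfolding unit by (simp only: of_real_add of_real_diff of_real_1 complex_norm_square)
    then have "(cmod z0)\<^sup>2 + (cmod z1)\<^sup>2 = 1 - (cmod ?t)\<^sup>2"
      by (simp only: of_real_eq_iff)
    then show ?thesis by simp
  qed
  let ?U = "mat2 y0 (- cnj y1) y1 (cnj y0)"
  define \<sigma> where "\<sigma> = y0 * z1 - y1 * z0"
  have U: "?U \<in> unitary_mats 2" by (rule unit_vector_unitary[OF yy])
  have "y0 * (cnj y0 * z0 + cnj y1 * z1) = 0" "y1 * (cnj y0 * z0 + cnj y1 * z1) = 0"
    using yz by simp_all
  then have "- cnj y1 * \<sigma> = z0 * (y0 * cnj y0 + y1 * cnj y1)" "cnj y0 * \<sigma> = z1 * (y0 * cnj y0 + y1 * cnj y1)"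
    by (simp_all add: \<sigma>_def algebra_simps)
  then have z: "z0 = - cnj y1 * \<sigma>" "z1 = cnj y0 * \<sigma>"
    using yy by simp_all
  have "(cmod \<sigma>)\<^sup>2 = (cmod z0)\<^sup>2 + (cmod z1)\<^sup>2"
  proof -
    have "complex_of_real ((cmod z0)\<^sup>2 + (cmod z1)\<^sup>2) = \<sigma> * cnj \<sigma> * (y0 * cnj y0 + y1 * cnj y1)"
      unfolding of_real_add complex_norm_square z by (simp add: algebra_simps)
    also have "\<dots> = of_real ((cmod \<sigma>)\<^sup>2)"
      by (simp only: yy complex_norm_square mult_1_right)
    finally show ?thesis by (simp only: of_real_eq_iff)
  qed
  with zz have "cmod \<sigma> \<le> 1"
    by (simp add: power2_le_imp_le[of _ 1])
  moreover have "corner2 V = ?U * mat2 1 0 0 \<sigma> * mat_adjoint ?W"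
  proof -
    have "?U * mat2 1 0 0 \<sigma> = corner2 V * ?W"
      unfolding XW mat2_mult using z by (simp add: mat2_eq_iff)
    then have "?U * mat2 1 0 0 \<sigma> * mat_adjoint ?W = corner2 V * (?W * mat_adjoint ?W)"
      by (simp add: corner2_def square_mult_assoc[of _ 2])
    then show ?thesis
      using unitary_matsD(3)[OF W] by (simp add: corner2_def)
  qed
  ultimately show thesis using U W that by blast
qed

section \<open>Contractions and the padded range\<close>

lemma rel_num_range_mat2_phase:
  assumes "cmod \<rho> = 1"
  shows "a * (p - t) + (\<rho> * b * r + cnj \<rho> * c * q) \<in> rel_num_range (mat2 a b c (- a)) (mat2 p q r t)"
proof -
  have \<rho>: "\<rho> * cnj \<rho> = 1" using assms complex_norm_square[of \<rho>] by simp
  have V: "mat2 1 0 0 \<rho> \<in> unitary_mats 2"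
    using \<rho> by (simp add: mat2_unitary_iff)
  have "mat_trace (mat2 a b c (- a) * (mat2 1 0 0 \<rho> * mat2 p q r t * mat_adjoint (mat2 1 0 0 \<rho>)))
    = a * (p - t * (\<rho> * cnj \<rho>)) + (\<rho> * b * r + cnj \<rho> * c * q)"
    unfolding mat2_mult mat2_adjoint mat_trace_mat2 by (simp add: algebra_simps)
  also have "\<dots> = a * (p - t) + (\<rho> * b * r + cnj \<rho> * c * q)"
    by (simp add: \<rho>)
  finally show ?thesis
    using rel_num_rangeI[OF mat2_carrier V] by metis
qed

text \<open>The points for \<open>\<rho>\<close> and \<open>-\<rho>\<close> differ in the sign of the off-diagonal part, so by convexity
  that part can be multiplied by any real \<open>k\<close> between \<open>-1\<close> and \<open>1\<close>.\<close>

lemma rel_num_range_mat2_shrink: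
  assumes \<rho>: "cmod \<rho> = 1" and k: "\<bar>k\<bar> \<le> 1"
  shows "a * (p - t) + of_real k * (\<rho> * b * r + cnj \<rho> * c * q) \<in> rel_num_range (mat2 a b c (- a)) (mat2 p q r t)"
    (is "?z \<in> ?W")
proof -
  let ?e = "\<rho> * b * r + cnj \<rho> * c * q"
  have 1: "a * (p - t) + ?e \<in> ?W" by (rule rel_num_range_mat2_phase[OF \<rho>])
  have 2: "a * (p - t) - ?e \<in> ?W"
    using rel_num_range_mat2_phase[of "- \<rho>" a p t b r c q] \<rho> by (simp add: algebra_simps)
  have "((1 + k) / 2) *\<^sub>R (a * (p - t) + ?e) + ((1 - k) / 2) *\<^sub>R (a * (p - t) - ?e) \<in> ?W"
    by (rule convexD[OF convex_rel_num_range_2 1 2]) (use k in \<open>auto simp: field_simps\<close>)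
  also have "((1 + k) / 2) *\<^sub>R (a * (p - t) + ?e) + ((1 - k) / 2) *\<^sub>R (a * (p - t) - ?e) = ?z"
    by (simp add: scaleR_conv_of_real field_simps)
  finally show ?thesis .
qed

text \<open>The convex combination that replaces \<open>diag(1, \<sigma>)\<close> by unitary matrices.\<close>

lemma rel_num_range_contraction:
  assumes "a * (p + t) \<in> rel_num_range (mat2 a b c (- a)) (mat2 p q r t)" (is "_ \<in> ?W")
    and \<sigma>: "cmod \<sigma> \<le> 1"
  shows "mat_trace (mat2 a b c (- a) * (mat2 1 0 0 \<sigma> * mat2 p q r t * mat_adjoint (mat2 1 0 0 \<sigma>))) \<in> ?W"
proof -
  define s where "s = cmod \<sigma>"
  obtain \<rho> where \<rho>: "cmod \<rho> = 1" "\<sigma> = of_real s * \<rho>"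
  proof (cases "\<sigma> = 0")
    case True then show thesis using that[of 1] by (simp add: s_def)
  next
    case False then show thesis using that[of "sgn \<sigma>"] by (simp only: s_def norm_sgn) (simp add: sgn_eq)
  qed
  have s: "0 \<le> s" "s \<le> 1" using \<sigma> by (auto simp: s_def)
  have rr: "\<rho> * cnj \<rho> = 1" using \<rho> complex_norm_square[of \<rho>] by simp
  let ?e = "\<rho> * b * r + cnj \<rho> * c * q"
  have s2: "1 + s * s > 0" by (simp add: add_pos_nonneg)
  define k where "k = 2 * s / (1 + s * s)"
  have "2 * s \<le> 1 + s * s"
    using zero_le_square[of "1 - s"] by (simp add: algebra_simps)
  then have k: "\<bar>k\<bar> \<le> 1" using s s2 by (simp add: k_def)
  have ks: "(1 + s * s) / 2 * k = s" using s2 by (simp add: k_def)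
  have "mat_trace (mat2 a b c (- a) * (mat2 1 0 0 \<sigma> * mat2 p q r t * mat_adjoint (mat2 1 0 0 \<sigma>)))
    = a * (p - of_real (s * s) * t * (\<rho> * cnj \<rho>)) + of_real s * ?e"
    unfolding mat2_mult mat2_adjoint mat_trace_mat2 \<rho>(2) by (simp add: algebra_simps)
  also have "\<dots> = a * (p - of_real (s * s) * t) + of_real ((1 + s * s) / 2 * k) * ?e"
    unfolding rr ks by simp
  also have "\<dots> = ((1 - s * s) / 2) *\<^sub>R (a * (p + t)) + ((1 + s * s) / 2) *\<^sub>R (a * (p - t) + of_real k * ?e)"
    by (simp add: scaleR_conv_of_real field_simps)
  also have "\<dots> \<in> ?W"
    by (rule convexD[OF convex_rel_num_range_2 assms(1) rel_num_range_mat2_shrink[OF \<rho>(1) k]])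
      (use s in \<open>auto simp: mult_le_one field_simps\<close>)
  finally show ?thesis .
qed

text \<open>For a unit vector \<open>x\<close> with \<open>x\<^sup>* B\<^sub>0 x = tr B / 2\<close> one has \<open>x\<^sup>* B x = tr B\<close>, so a unitary matrix with first column \<open>x\<close>
  conjugates \<open>B\<close> to a matrix with diagonal \<open>(tr B, 0)\<close>.\<close>

lemma conj_entry_times_trace_mem_rel_num_range:
  assumes A: "A \<in> carrier_mat 2 2" "mat_trace A = 0" and B: "B \<in> carrier_mat 2 2"
    and U: "U \<in> unitary_mats 2"
    and tr: "1 / 2 * mat_trace B \<in> num_range (traceless_part B)"
  shows "(mat_adjoint U * A * U) $$ (0, 0) * mat_trace B \<in> rel_num_range A B"
proof -
  obtain p q r t where Bm: "B = mat2 p q r t" using mat2_entries[OF B] by blast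
  let ?\<beta> = "(p + t) / 2"
  have B0: "traceless_part B = mat2 (p - ?\<beta>) q r (t - ?\<beta>)"
    unfolding traceless_part_def by (rule mat2_eqI) (auto simp: Bm mat_trace_mat2)
  obtain x where "x \<in> carrier_vec (dim_row (traceless_part B))" "x \<bullet>c x = 1"
    "1 / 2 * mat_trace B = (traceless_part B *\<^sub>v x) \<bullet>c x"
    using tr unfolding num_range_def by blast
  then have x: "x \<in> carrier_vec 2" "x \<bullet>c x = 1" "?\<beta> = (traceless_part B *\<^sub>v x) \<bullet>c x"
    unfolding B0 by (simp_all add: Bm mat_trace_mat2)
  define v w where "v = x $ 0" "w = x $ 1"
  have unit: "v * cnj v + w * cnj w = 1"
    using x by (simp add: scalar_prod_def v_w_def numeral_2_eq_2)
  have "?\<beta> = ((p - ?\<beta>) * v + q * w) * cnj v + (r * v + (t - ?\<beta>) * w) * cnj w"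
    using x(1,3) unfolding B0
    by (simp add: scalar_prod_def v_w_def numeral_2_eq_2)
  also have "\<dots> = (p * (v * cnj v) + q * (cnj v * w) + r * (v * cnj w) + t * (w * cnj w)) - ?\<beta> * (v * cnj v + w * cnj w)"
    by (simp add: algebra_simps)
  finally have "?\<beta> + ?\<beta> = p * (v * cnj v) + q * (cnj v * w) + r * (v * cnj w) + t * (w * cnj w)"
    unfolding unit mult_1_right eq_diff_eq .
  moreover have "?\<beta> + ?\<beta> = p + t"
    by (simp add: field_simps)
  ultimately have val: "p * (v * cnj v) + q * (cnj v * w) + r * (v * cnj w) + t * (w * cnj w) = p + t"
    by metis
  obtain Y q' r' where Y: "Y \<in> unitary_mats 2" "mat_adjoint Y * B * Y = mat2 (p + t) q' r' 0"
    using unitary_conj_first_entry[OF unit, of p q r t, folded Bm] unfolding val by auto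
  have A': "mat_adjoint U * A * U \<in> carrier_mat 2 2"
    using A(1) unitary_matsD(1)[OF U] by (intro square_mult_carrier mat_adjoint_carrier)
  obtain a b c d where Am: "mat_adjoint U * A * U = mat2 a b c d" using mat2_entries[OF A'] by blast
  have "mat_trace (mat_adjoint U * A * U) = mat_trace A"
    using mat_trace_unitary A U by simp
  then have d: "d = - a"
    unfolding Am mat_trace_mat2 A(2) by (simp add: add_eq_0_iff)
  \<comment> \<open>The case \<open>k = 0\<close>: the midpoint of the two points with opposite off-diagonal parts.\<close>
  have "a * (p + t - 0) + of_real 0 * (1 * b * r' + cnj 1 * c * q') \<in> rel_num_range (mat2 a b c (- a)) (mat2 (p + t) q' r' 0)"
    by (rule rel_num_range_mat2_shrink) auto
  then show ?thesis
    using rel_num_range_unitary_conj[OF A(1) B U Y(1)] unfolding Am Y(2) d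
    by (simp add: Bm mat_trace_mat2)
qed

theorem corollary13:
  fixes A B :: "complex mat"
  assumes "A \<in> carrier_mat 2 2" and "B \<in> carrier_mat 2 2"
    and "mat_trace A = 0"
    and "1 / 2 * mat_trace B \<in> num_range (traceless_part B)"
  shows "rel_num_range A B = rel_num_range (pad_zero A) (pad_zero B)"
proof (intro equalityI subsetI)
  note A = assms(1) and B = assms(2)
  fix z assume "z \<in> rel_num_range A B"
  then obtain V where V: "V \<in> unitary_mats 2" "z = mat_trace (A * (V * B * mat_adjoint V))"
    using B by (rule rel_num_rangeE)
  obtain V' where V': "V' \<in> unitary_mats 3" "corner2 V' = V"
    using corner2_extension[OF V(1)] .
  have "z = mat_trace (pad_zero A * (V' * pad_zero B * mat_adjoint V'))"
    using mat_trace_pad_zero[OF A B unitary_matsD(1)[OF V'(1)]] V(2) V'(2) by simp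
  then show "z \<in> rel_num_range (pad_zero A) (pad_zero B)"
    using rel_num_rangeI[OF pad_zero_carrier[OF B] V'(1)] by metis
next
  note A = assms(1) and B = assms(2)
  fix z assume "z \<in> rel_num_range (pad_zero A) (pad_zero B)"
  then obtain V where V: "V \<in> unitary_mats 3" "z = mat_trace (pad_zero A * (V * pad_zero B * mat_adjoint V))"
    using pad_zero_carrier[OF B] by (rule rel_num_rangeE)
  obtain U W \<sigma> where U: "U \<in> unitary_mats 2" and W: "W \<in> unitary_mats 2" and \<sigma>: "cmod \<sigma> \<le> 1"
    and X: "corner2 V = U * mat2 1 0 0 \<sigma> * mat_adjoint W"
    using corner2_svd[OF V(1)] .
  let ?A = "mat_adjoint U * A * U" and ?B = "mat_adjoint W * B * W" and ?D = "mat2 1 0 0 \<sigma>"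
  have "?A \<in> carrier_mat 2 2" "?B \<in> carrier_mat 2 2"
    using A B unitary_matsD(1)[OF U] unitary_matsD(1)[OF W]
    by (auto intro!: square_mult_carrier mat_adjoint_carrier)
  then obtain a b c d p q r t where Am: "?A = mat2 a b c d" and Bm: "?B = mat2 p q r t"
    using mat2_entries by metis
  have "d = - a"
    using mat_trace_unitary[OF A U] assms(3) unfolding Am mat_trace_mat2 by (simp add: add_eq_0_iff)
  note Am = Am[unfolded this]
  have "p + t = mat_trace B"
    using mat_trace_unitary[OF B W] unfolding Bm mat_trace_mat2 .
  then have "a * (p + t) \<in> rel_num_range A B"
    using conj_entry_times_trace_mem_rel_num_range[OF A assms(3) B U assms(4)] unfolding Am by simp
  then have "mat_trace (?A * (?D * ?B * mat_adjoint ?D)) \<in> rel_num_range A B"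
    using rel_num_range_contraction[OF _ \<sigma>] rel_num_range_unitary_conj[OF A B U W]
    unfolding Am Bm by metis
  also have "mat_trace (?A * (?D * ?B * mat_adjoint ?D)) = z"
    unfolding V(2) mat_trace_pad_zero[OF A B unitary_matsD(1)[OF V(1)]] X
    by (rule mat_trace_unitary_conj[OF A B mat2_carrier unitary_matsD(1)[OF U] unitary_matsD(1)[OF W]])
  finally show "z \<in> rel_num_range A B" .
qed

end
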